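(* The canonical functor $F\colon\mathrm{CP}^*[\mathbf{Rel}]\to\mathrm{Split}^\dagger[\mathrm{CPM}[\mathbf{Rel}]]$ is not an equivalence of categories.
   Context: $\mathbf{Rel}$ is the category of sets and relations; composition is relational composition and the dagger is relational converse. $\mathrm{CP}^*[\mathbf{Rel}]$: objects are small groupoids; morphisms $\mathbf{G}\to\mathbf{H}$ are relations $R\subseteq\mathrm{Mor}(\mathbf{G})\times\mathrm{Mor}(\mathbf{H})$ such that $gRh$ implies $g^{-1}Rh^{-1}$ and $1_{\mathrm{dom}(g)}\,R\,1_{\mathrm{dom}(h)}$. Composition, identities and dagger are those of $\mathbf{Rel}$. $\mathrm{CPM}[\mathbf{Rel}]$: objects are sets; morphisms $X\to Y$ are relations $R\colon X\times X\to Y\times Y$ such that $(x,x')R(y,y')$ implies $(x',x)R(y',y)$ and $(x,x)R(y,y)$. Composition, identities and dagger are those of $\mathbf{Rel}$. $\mathrm{Split}^\dagger[\mathbf{C}]$, for a dagger category $\mathbf{C}$: objects are pairs $(X,p)$ with $p\colon X\to X$ a dagger idempotent ($p^\dagger=p=p\circ p$); morphisms $(X,p)\to(Y,q)$ are morphisms $f\colon X\to Y$ of $\mathbf{C}$ with $f=q\circ f\circ p$; composition and dagger are those of $\mathbf{C}$, and the identity of $(X,p)$ is $p$. The canonical functor $F$: on objects $F(\mathbf{G})=(\mathrm{Mor}(\mathbf{G}),\sim)$, where $(a,b)\sim(c,d)$ if and only if $a^{-1}b$ and $c^{-1}d$ are both defined and equal; on morphisms $R\colon\mathbf{G}\to\mathbf{H}$,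 $F(R)$ relates $(a,b)$ to $(c,d)$ if and only if $a^{-1}b$ and $c^{-1}d$ are both defined and $(a^{-1}b)\,R\,(c^{-1}d)$. *)

theory Defs
  imports "HOL-Library.FuncSet"
begin

section \<open>Categories, functors, equivalences\<close>

text \<open>\<open>Comp C g f\<close> is "g after f". Values of the operations outside their intended domains are
  irrelevant, here and for \<open>dagger_data\<close> and \<open>functor_data\<close>.\<close>

record ('o, 'm) category_data =
  Ob :: "'o set"
  Mor :: "'m set"
  Dom :: "'m \<Rightarrow> 'o"
  Cod :: "'m \<Rightarrow> 'o"
  One :: "'o \<Rightarrow> 'm"
  Comp :: "'m \<Rightarrow> 'm \<Rightarrow> 'm"

definition composable :: "('o, 'm, 'z) category_data_scheme \<Rightarrow> 'm \<Rightarrow> 'm \<Rightarrow> bool" where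
  "composable C g f \<longleftrightarrow> g \<in> Mor C \<and> f \<in> Mor C \<and> Dom C g = Cod C f"

locale category =
  fixes C :: "('o, 'm, 'z) category_data_scheme"
  assumes Dom_in: "f \<in> Mor C \<Longrightarrow> Dom C f \<in> Ob C"
    and Cod_in: "f \<in> Mor C \<Longrightarrow> Cod C f \<in> Ob C"
    and One_in: "A \<in> Ob C \<Longrightarrow> One C A \<in> Mor C"
    and Dom_One: "A \<in> Ob C \<Longrightarrow> Dom C (One C A) = A"
    and Cod_One: "A \<in> Ob C \<Longrightarrow> Cod C (One C A) = A"
    and Comp_in: "composable C g f \<Longrightarrow> Comp C g f \<in> Mor C"
    and Dom_Comp: "composable C g f \<Longrightarrow> Dom C (Comp C g f) = Dom C f"
    and Cod_Comp: "composable C g f \<Longrightarrow> Cod C (Comp C g f) = Cod C g"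
    and Comp_One_left: "f \<in> Mor C \<Longrightarrow> Comp C (One C (Cod C f)) f = f"
    and Comp_One_right: "f \<in> Mor C \<Longrightarrow> Comp C f (One C (Dom C f)) = f"
    and Comp_assoc: "composable C h g \<Longrightarrow> composable C g f \<Longrightarrow>
      Comp C (Comp C h g) f = Comp C h (Comp C g f)"

definition inverse_morphisms :: "('o, 'm, 'z) category_data_scheme \<Rightarrow> 'm \<Rightarrow> 'm \<Rightarrow> bool" where
  "inverse_morphisms C f g \<longleftrightarrow> composable C g f \<and> composable C f g \<and>
     Comp C g f = One C (Dom C f) \<and> Comp C f g = One C (Cod C f)"

definition is_iso :: "('o, 'm, 'z) category_data_scheme \<Rightarrow> 'm \<Rightarrow> bool" where
  "is_iso C f \<longleftrightarrow> (\<exists>g. inverse_morphisms C f g)"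

definition inv_mor :: "('o, 'm, 'z) category_data_scheme \<Rightarrow> 'm \<Rightarrow> 'm" where
  "inv_mor C f = (THE g. inverse_morphisms C f g)"

record ('o1, 'm1, 'o2, 'm2) functor_data =
  on_Ob :: "'o1 \<Rightarrow> 'o2"
  on_Mor :: "'m1 \<Rightarrow> 'm2"

definition is_functor :: "('o1, 'm1, 'y) category_data_scheme \<Rightarrow> ('o2, 'm2, 'z) category_data_scheme
    \<Rightarrow> ('o1, 'm1, 'o2, 'm2) functor_data \<Rightarrow> bool" where
  "is_functor C D F \<longleftrightarrow> category C \<and> category D \<and>
     (\<forall>A\<in>Ob C. on_Ob F A \<in> Ob D) \<and>
     (\<forall>f\<in>Mor C. on_Mor F f \<in> Mor D \<and>
        Dom D (on_Mor F f) = on_Ob F (Dom C f) \<and> Cod D (on_Mor F f) = on_Ob F (Cod C f)) \<and>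
     (\<forall>A\<in>Ob C. on_Mor F (One C A) = One D (on_Ob F A)) \<and>
     (\<forall>g f. composable C g f \<longrightarrow> on_Mor F (Comp C g f) = Comp D (on_Mor F g) (on_Mor F f))"

definition id_functor :: "('o, 'm, 'o, 'm) functor_data" where
  "id_functor = \<lparr>on_Ob = \<lambda>A. A, on_Mor = \<lambda>f. f\<rparr>"

definition comp_functor :: "('o2, 'm2, 'o3, 'm3) functor_data \<Rightarrow> ('o1, 'm1, 'o2, 'm2) functor_data
    \<Rightarrow> ('o1, 'm1, 'o3, 'm3) functor_data" where
  "comp_functor G F = \<lparr>on_Ob = on_Ob G \<circ> on_Ob F, on_Mor = on_Mor G \<circ> on_Mor F\<rparr>"

definition naturally_isomorphic ::
  "('o1, 'm1, 'y) category_data_scheme \<Rightarrow> ('o2, 'm2, 'z) category_data_scheme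
    \<Rightarrow> ('o1, 'm1, 'o2, 'm2) functor_data \<Rightarrow> ('o1, 'm1, 'o2, 'm2) functor_data \<Rightarrow> bool" where
  "naturally_isomorphic C D F G \<longleftrightarrow> (\<exists>\<tau>.
     (\<forall>A\<in>Ob C. \<tau> A \<in> Mor D \<and> Dom D (\<tau> A) = on_Ob F A \<and> Cod D (\<tau> A) = on_Ob G A \<and> is_iso D (\<tau> A)) \<and>
     (\<forall>f\<in>Mor C. Comp D (\<tau> (Cod C f)) (on_Mor F f) = Comp D (on_Mor G f) (\<tau> (Dom C f))))"

definition is_equivalence ::
  "('o1, 'm1, 'y) category_data_scheme \<Rightarrow> ('o2, 'm2, 'z) category_data_scheme
    \<Rightarrow> ('o1, 'm1, 'o2, 'm2) functor_data \<Rightarrow> bool" where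
  "is_equivalence C D F \<longleftrightarrow> is_functor C D F \<and>
     (\<exists>G. is_functor D C G \<and>
          naturally_isomorphic C C (comp_functor G F) id_functor \<and>
          naturally_isomorphic D D (comp_functor F G) id_functor)"


section \<open>Dagger categories and splitting of dagger idempotents\<close>

record ('o, 'm) dagger_data = "('o, 'm) category_data" +
  Dag :: "'m \<Rightarrow> 'm"

locale dagger_category = category C for C :: "('o, 'm, 'z) dagger_data_scheme" +
  assumes Dag_in: "f \<in> Mor C \<Longrightarrow> Dag C f \<in> Mor C"
    and Dom_Dag: "f \<in> Mor C \<Longrightarrow> Dom C (Dag C f) = Cod C f"
    and Cod_Dag: "f \<in> Mor C \<Longrightarrow> Cod C (Dag C f) = Dom C f"
    and Dag_One: "A \<in> Ob C \<Longrightarrow> Dag C (One C A) = One C A"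
    and Dag_Comp: "composable C g f \<Longrightarrow> Dag C (Comp C g f) = Comp C (Dag C f) (Dag C g)"
    and Dag_Dag: "f \<in> Mor C \<Longrightarrow> Dag C (Dag C f) = f"

definition dagger_idempotent :: "('o, 'm, 'z) dagger_data_scheme \<Rightarrow> 'o \<Rightarrow> 'm \<Rightarrow> bool" where
  "dagger_idempotent C X p \<longleftrightarrow> X \<in> Ob C \<and> p \<in> Mor C \<and> Dom C p = X \<and> Cod C p = X \<and>
     Dag C p = p \<and> p = Comp C p p"

text \<open>In the concrete categories below a morphism is a triple (domain, underlying datum, codomain),
  so that it determines its domain and codomain.\<close>

definition Split :: "('o, 'm, 'z) dagger_data_scheme
    \<Rightarrow> ('o \<times> 'm, ('o \<times> 'm) \<times> 'm \<times> ('o \<times> 'm)) dagger_data" where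
  "Split C =
    \<lparr>Ob = {(X, p). dagger_idempotent C X p},
     Mor = {((X, p), f, (Y, q)) | X p f Y q.
       dagger_idempotent C X p \<and> dagger_idempotent C Y q \<and>
       f \<in> Mor C \<and> Dom C f = X \<and> Cod C f = Y \<and> f = Comp C q (Comp C f p)},
     Dom = \<lambda>(A, f, B). A,
     Cod = \<lambda>(A, f, B). B,
     One = \<lambda>(X, p). ((X, p), p, (X, p)),
     Comp = \<lambda>(B', g, E) (A, f, B). (A, Comp C g f, E),
     Dag = \<lambda>(A, f, B). (B, Dag C f, A)\<rparr>"


section \<open>The categories CP*[Rel] and CPM[Rel]\<close>

text \<open>\<open>rel_cat Obs car H\<close> has objects \<open>Obs\<close>; its morphisms from \<open>A\<close> to \<open>B\<close> are the relations
  between the sets \<open>car A\<close> and \<open>car B\<close> that lie in \<open>H A B\<close>; composition, identities and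
  dagger are those of the category of sets and relations. Note that \<open>R O S\<close> is "first R, then S".\<close>

definition rel_cat :: "'o set \<Rightarrow> ('o \<Rightarrow> 'e set) \<Rightarrow> ('o \<Rightarrow> 'o \<Rightarrow> 'e rel set)
    \<Rightarrow> ('o, 'o \<times> 'e rel \<times> 'o) dagger_data" where
  "rel_cat Obs car H =
    \<lparr>Ob = Obs,
     Mor = {(A, R, B). A \<in> Obs \<and> B \<in> Obs \<and> R \<subseteq> car A \<times> car B \<and> R \<in> H A B},
     Dom = \<lambda>(A, R, B). A,
     Cod = \<lambda>(A, R, B). B,
     One = \<lambda>A. (A, Id_on (car A), A),
     Comp = \<lambda>(B', S, E) (A, R, B). (A, R O S, E),
     Dag = \<lambda>(A, R, B). (B, R\<inverse>, A)\<rparr>"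

text \<open>HOL has no type of all sets, so the sets of the ambient set theory are modelled by a family
  \<open>U\<close> of subsets of a type. The assumptions are deliberately weak: \<open>U\<close> may consist of all subsets
  of an arbitrary infinite type, and if \<open>'u\<close> is (the type of elements of) a universe of set theory,
  \<open>U\<close> may consist of those collections that are sets.\<close>

definition set_universe :: "'u set set \<Rightarrow> bool" where
  "set_universe U \<longleftrightarrow> infinite (UNIV :: 'u set) \<and> (\<forall>A. finite A \<longrightarrow> A \<in> U)"

definition groupoid :: "('o, 'm, 'z) category_data_scheme \<Rightarrow> bool" where
  "groupoid G \<longleftrightarrow> category G \<and> (\<forall>g\<in>Mor G. is_iso G g)"

text \<open>The last four conditions fix the values of the operations outside their domains, so
  that two small groupoids are equal as records iff they are the same groupoid.\<close>

definition small_groupoid :: "'u set set \<Rightarrow> ('u, 'u) category_data \<Rightarrow> bool" where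
  "small_groupoid U G \<longleftrightarrow> groupoid G \<and> Ob G \<in> U \<and> Mor G \<in> U \<and>
     Dom G \<in> extensional (Mor G) \<and> Cod G \<in> extensional (Mor G) \<and>
     One G \<in> extensional (Ob G) \<and>
     (\<forall>g f. \<not> composable G g f \<longrightarrow> Comp G g f = undefined)"

definition CPstar_Rel :: "'u set set
    \<Rightarrow> (('u, 'u) category_data, ('u, 'u) category_data \<times> 'u rel \<times> ('u, 'u) category_data) dagger_data"
  where
  "CPstar_Rel U = rel_cat {G. small_groupoid U G} Mor
     (\<lambda>G H. {R. \<forall>(g, h)\<in>R. (inv_mor G g, inv_mor H h) \<in> R \<and>
                            (One G (Dom G g), One H (Dom H h)) \<in> R})"

definition CPM_Rel :: "'u set set
    \<Rightarrow> ('u set, 'u set \<times> ('u \<times> 'u) rel \<times> 'u set) dagger_data" where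
  "CPM_Rel U = rel_cat U (\<lambda>X. X \<times> X)
     (\<lambda>X Y. {R. \<forall>((x, x'), (y, y'))\<in>R. ((x', x), (y', y)) \<in> R \<and> ((x, x), (y, y)) \<in> R})"


section \<open>The canonical functor\<close>

text \<open>\<open>quot_rel G H R\<close> relates (a, b) to (c, d) iff \<open>a\<^sup>-\<^sup>1 b\<close> and \<open>c\<^sup>-\<^sup>1 d\<close> are defined and related by
  \<open>R\<close>; for \<open>H = G\<close> and \<open>R = Id\<close> it is the equivalence \<open>\<sim>\<close> of the object part.\<close>

definition quot_rel :: "('u, 'u) category_data \<Rightarrow> ('u, 'u) category_data \<Rightarrow> 'u rel
    \<Rightarrow> ('u \<times> 'u) rel" where
  "quot_rel G H R = {((a, b), (c, d)) | a b c d.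
     a \<in> Mor G \<and> b \<in> Mor G \<and> c \<in> Mor H \<and> d \<in> Mor H \<and>
     composable G (inv_mor G a) b \<and> composable H (inv_mor H c) d \<and>
     (Comp G (inv_mor G a) b, Comp H (inv_mor H c) d) \<in> R}"

definition can_ob :: "('u, 'u) category_data \<Rightarrow> 'u set \<times> ('u set \<times> ('u \<times> 'u) rel \<times> 'u set)" where
  "can_ob G = (Mor G, (Mor G, quot_rel G G Id, Mor G))"

definition canonical_functor ::
  "(('u, 'u) category_data, ('u, 'u) category_data \<times> 'u rel \<times> ('u, 'u) category_data,
    'u set \<times> ('u set \<times> ('u \<times> 'u) rel \<times> 'u set),
    ('u set \<times> ('u set \<times> ('u \<times> 'u) rel \<times> 'u set)) \<times> ('u set \<times> ('u \<times> 'u) rel \<times> 'u set)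
      \<times> ('u set \<times> ('u set \<times> ('u \<times> 'u) rel \<times> 'u set))) functor_data" where
  "canonical_functor =
    \<lparr>on_Ob = can_ob,
     on_Mor = \<lambda>(G, R, H). (can_ob G, (Mor G, quot_rel G H R, Mor H), can_ob H)\<rparr>"


section \<open>Well-definedness\<close>


lemma rel_cat_simps:
  "Ob (rel_cat Obs car H) = Obs"
  "(A, R, B) \<in> Mor (rel_cat Obs car H) \<longleftrightarrow>
    A \<in> Obs \<and> B \<in> Obs \<and> R \<subseteq> car A \<times> car B \<and> R \<in> H A B"
  "Dom (rel_cat Obs car H) (A, R, B) = A"
  "Cod (rel_cat Obs car H) (A, R, B) = B"
  "One (rel_cat Obs car H) A = (A, Id_on (car A), A)"
  "Comp (rel_cat Obs car H) (B', S, E) (A, R, B) = (A, R O S, E)"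
  "Dag (rel_cat Obs car H) (A, R, B) = (B, R\<inverse>, A)"
  by (auto simp: rel_cat_def)

lemma rel_cat_dagger_category:
  assumes H_One: "\<And>A. A \<in> Obs \<Longrightarrow> Id_on (car A) \<in> H A A"
    and H_Comp: "\<And>A B E R S. \<lbrakk>A \<in> Obs; B \<in> Obs; E \<in> Obs; R \<subseteq> car A \<times> car B; S \<subseteq> car B \<times> car E;
           R \<in> H A B; S \<in> H B E\<rbrakk> \<Longrightarrow> R O S \<in> H A E"
    and H_Dag: "\<And>A B R. R \<in> H A B \<Longrightarrow> R\<inverse> \<in> H B A"
  shows "dagger_category (rel_cat Obs car H)"
proof
  fix h g f :: "'a \<times> 'b rel \<times> 'a"
  obtain A R B where f: "f = (A, R, B)" by (cases f)
  obtain B' S E where g: "g = (B', S, E)" by (cases g)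
  obtain E' T K where h: "h = (E', T, K)" by (cases h)
  note s = rel_cat_simps f g h
  let ?C = "rel_cat Obs car H"
  show "Dom ?C f \<in> Ob ?C" if "f \<in> Mor ?C" using that by (simp add: s)
  show "Cod ?C f \<in> Ob ?C" if "f \<in> Mor ?C" using that by (simp add: s)
  show "Comp ?C (One ?C (Cod ?C f)) f = f" if "f \<in> Mor ?C" using that by (auto simp: s)
  show "Comp ?C f (One ?C (Dom ?C f)) = f" if "f \<in> Mor ?C" using that by (auto simp: s)
  show "Dag ?C f \<in> Mor ?C" if "f \<in> Mor ?C" using that H_Dag by (auto simp: s)
  show "Dom ?C (Dag ?C f) = Cod ?C f" by (simp add: s)
  show "Cod ?C (Dag ?C f) = Dom ?C f" by (simp add: s)
  show "Dag ?C (Dag ?C f) = f" by (simp add: s)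
  show "Dom ?C (Comp ?C g f) = Dom ?C f" by (simp add: s)
  show "Cod ?C (Comp ?C g f) = Cod ?C g" by (simp add: s)
  show "Dag ?C (Comp ?C g f) = Comp ?C (Dag ?C f) (Dag ?C g)"
    by (simp add: s converse_relcomp)
  show "Comp ?C (Comp ?C h g) f = Comp ?C h (Comp ?C g f)" by (simp add: s O_assoc)
  show "Comp ?C g f \<in> Mor ?C" if "composable ?C g f"
  proof -
    have "A \<in> Obs" "B \<in> Obs" "E \<in> Obs" "R \<subseteq> car A \<times> car B" "S \<subseteq> car B \<times> car E" "R \<in> H A B" "S \<in> H B E"
      using that by (auto simp: s composable_def)
    then show ?thesis using H_Comp by (auto simp: s)
  qed
next
  fix A assume "A \<in> Ob (rel_cat Obs car H)"
  then show "One (rel_cat Obs car H) A \<in> Mor (rel_cat Obs car H)"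
    and "Dom (rel_cat Obs car H) (One (rel_cat Obs car H) A) = A"
    and "Cod (rel_cat Obs car H) (One (rel_cat Obs car H) A) = A"
    and "Dag (rel_cat Obs car H) (One (rel_cat Obs car H) A) = One (rel_cat Obs car H) A"
    using H_One by (auto simp: rel_cat_simps)
qed

lemma (in category) inverse_unique:
  assumes "inverse_morphisms C f g" "inverse_morphisms C f g'"
  shows "g = g'"
proof -
  have "g = Comp C g (Comp C f g')"
    using assms by (metis Comp_One_right composable_def inverse_morphisms_def)
  also have "\<dots> = Comp C (Comp C g f) g'"
    using assms by (metis Comp_assoc inverse_morphisms_def)
  also have "\<dots> = g'"
    using assms by (metis Comp_One_left composable_def inverse_morphisms_def)
  finally show ?thesis .
qed

lemma (in category) inv_mor_inverse:
  assumes "is_iso C f"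
  shows "inverse_morphisms C f (inv_mor C f)"
proof -
  obtain g where g: "inverse_morphisms C f g" using assms by (auto simp: is_iso_def)
  show ?thesis unfolding inv_mor_def
    by (rule theI[of "inverse_morphisms C f", OF g]) (rule inverse_unique[OF _ g])
qed

lemma (in category) inv_mor_eqI:
  assumes "inverse_morphisms C f g"
  shows "inv_mor C f = g"
proof -
  have "is_iso C f" using assms by (auto simp: is_iso_def)
  from inverse_unique[OF inv_mor_inverse[OF this] assms] show ?thesis .
qed

lemma groupoid_inverse:
  assumes "groupoid G" "g \<in> Mor G"
  shows "inv_mor G g \<in> Mor G" "Dom G (inv_mor G g) = Cod G g" "Cod G (inv_mor G g) = Dom G g"
    "Comp G (inv_mor G g) g = One G (Dom G g)" "Comp G g (inv_mor G g) = One G (Cod G g)"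
proof -
  have "inverse_morphisms G g (inv_mor G g)"
    using assms unfolding groupoid_def by (blast intro: category.inv_mor_inverse)
  then show "inv_mor G g \<in> Mor G" "Dom G (inv_mor G g) = Cod G g" "Cod G (inv_mor G g) = Dom G g"
    "Comp G (inv_mor G g) g = One G (Dom G g)" "Comp G g (inv_mor G g) = One G (Cod G g)"
    by (simp_all add: inverse_morphisms_def composable_def)
qed

lemma dagger_category_CPstar_Rel: "dagger_category (CPstar_Rel U)"
  unfolding CPstar_Rel_def
proof (rule rel_cat_dagger_category, goal_cases)
  case (1 G)
  then have G: "groupoid G" "category G" by (auto simp: small_groupoid_def groupoid_def)
  have "inv_mor G g \<in> Mor G" "One G (Dom G g) \<in> Mor G" if "g \<in> Mor G" for g
    using groupoid_inverse(1)[OF G(1) that] category.One_in[OF G(2) category.Dom_in[OF G(2) that]] .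
  then show ?case by (simp add: Id_on_iff Ball_def)
next
  case (2 G H K R S)
  show ?case
  proof (clarsimp, goal_cases)
    case (1 g h k)
    then have "(inv_mor G g, inv_mor H h) \<in> R" "(One G (Dom G g), One H (Dom H h)) \<in> R"
      "(inv_mor H h, inv_mor K k) \<in> S" "(One H (Dom H h), One K (Dom K k)) \<in> S"
      using 2 by auto
    then show ?case by auto
  qed
next
  case (3 G H R)
  then show ?case by auto
qed

lemma dagger_category_CPM_Rel: "dagger_category (CPM_Rel U)"
  unfolding CPM_Rel_def
proof (rule rel_cat_dagger_category, goal_cases)
  case (1 X)
  then show ?case by auto
next
  case (2 X Y Z R S)
  show ?case
  proof (clarsimp, goal_cases)
    case (1 x x' y y' z z')
    then have "((x', x), (y', y)) \<in> R" "((x, x), (y, y)) \<in> R"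
      "((y', y), (z', z)) \<in> S" "((y, y), (z, z)) \<in> S"
      using 2 by auto
    then show ?case by auto
  qed
next
  case (3 X Y R)
  then show ?case by auto
qed

lemma Split_simps:
  "(X, p) \<in> Ob (Split C) \<longleftrightarrow> dagger_idempotent C X p"
  "((X, p), f, (Y, q)) \<in> Mor (Split C) \<longleftrightarrow> dagger_idempotent C X p \<and> dagger_idempotent C Y q \<and>
       f \<in> Mor C \<and> Dom C f = X \<and> Cod C f = Y \<and> f = Comp C q (Comp C f p)"
  "Dom (Split C) (A, f, B) = A"
  "Cod (Split C) (A, f, B) = B"
  "One (Split C) (X, p) = ((X, p), p, (X, p))"
  "Comp (Split C) (B', g, E) (A, f, B) = (A, Comp C g f, E)"
  "Dag (Split C) (A, f, B) = (B, Dag C f, A)"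
  by (auto simp: Split_def)

lemma (in dagger_category) Split_absorb:
  assumes "((X, p), f, (Y, q)) \<in> Mor (Split C)"
  shows "Comp C q f = f" "Comp C f p = f"
proof -
  have *: "composable C f p" "composable C q f" "composable C p p" "composable C q q"
      "Comp C p p = p" "Comp C q q = q" and f: "Comp C q (Comp C f p) = f"
    using assms by (auto simp: Split_simps dagger_idempotent_def composable_def)
  have **: "composable C q (Comp C f p)" "composable C (Comp C f p) p"
    using * by (auto simp: composable_def Comp_in Dom_Comp Cod_Comp)
  show "Comp C q f = f"
    using Comp_assoc[OF *(4) **(1)] *(6) f by simp
  show "Comp C f p = f"
    using Comp_assoc[OF *(1,3)] *(5) f
      Comp_assoc[of q "Comp C f p" p] ** by simp
qed

lemma (in dagger_category) dagger_category_Split: "dagger_category (Split C)"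
proof
  fix h g f :: "('o \<times> 'm) \<times> 'm \<times> ('o \<times> 'm)"
  obtain X p f' Y q where f: "f = ((X, p), f', (Y, q))" by (metis prod.exhaust)
  obtain Y' q' g' Z r where g: "g = ((Y', q'), g', (Z, r))" by (metis prod.exhaust)
  obtain Z' r' h' W t where h: "h = ((Z', r'), h', (W, t))" by (metis prod.exhaust)
  note s = Split_simps f g h
  let ?C = "Split C"
  show "Dom ?C f \<in> Ob ?C" if "f \<in> Mor ?C" using that by (simp add: s)
  show "Cod ?C f \<in> Ob ?C" if "f \<in> Mor ?C" using that by (simp add: s)
  show "Comp ?C (One ?C (Cod ?C f)) f = f" if "f \<in> Mor ?C" 
    using Split_absorb(1)[OF that[unfolded f]] by (simp add: s)
  show "Comp ?C f (One ?C (Dom ?C f)) = f" if "f \<in> Mor ?C" 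
    using Split_absorb(2)[OF that[unfolded f]] by (simp add: s)
  show "Dag ?C f \<in> Mor ?C" if "f \<in> Mor ?C"
  proof -
    have a: "Comp C q f' = f'" "Comp C f' p = f'" using Split_absorb[OF that[unfolded f]] .
    have c: "composable C q f'" "composable C f' p" and d: "Dag C p = p" "Dag C q = q"
      using that by (auto simp: s dagger_idempotent_def composable_def)
    have "Comp C (Dag C f') q = Dag C f'" "Comp C p (Dag C f') = Dag C f'"
      using Dag_Comp[OF c(1)] Dag_Comp[OF c(2)] a d by simp_all
    then show ?thesis using that by (auto simp: s Dag_in Dom_Dag Cod_Dag)
  qed
  show "Dom ?C (Dag ?C f) = Cod ?C f" by (simp add: s)
  show "Cod ?C (Dag ?C f) = Dom ?C f" by (simp add: s)
  show "Dag ?C (Dag ?C f) = f" if "f \<in> Mor ?C" using that by (simp add: s Dag_Dag)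
  show "Dom ?C (Comp ?C g f) = Dom ?C f" by (simp add: s)
  show "Cod ?C (Comp ?C g f) = Cod ?C g" by (simp add: s)
  show "Dag ?C (Comp ?C g f) = Comp ?C (Dag ?C f) (Dag ?C g)" if "composable ?C g f"
    using that by (simp add: s composable_def Dag_Comp)
  show "Comp ?C (Comp ?C h g) f = Comp ?C h (Comp ?C g f)"
    if "composable ?C h g" "composable ?C g f"
    using that by (simp add: s composable_def Comp_assoc)
  show "Comp ?C g f \<in> Mor ?C" if "composable ?C g f"
  proof -
    have fg: "f \<in> Mor ?C" "g \<in> Mor ?C" using that by (auto simp: composable_def)
    have a: "Comp C r g' = g'" "Comp C f' p = f'" using Split_absorb(1)[OF fg(2)[unfolded g]] Split_absorb(2)[OF fg(1)[unfolded f]] .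
    have c: "composable C g' f'" "composable C f' p" "composable C r g'"
      using that by (auto simp: s dagger_idempotent_def composable_def)
    have "Comp C (Comp C g' f') p = Comp C g' f'" using c a by (simp add: Comp_assoc)
    moreover have "Comp C r (Comp C g' f') = Comp C g' f'" using Comp_assoc[OF c(3,1)] a by simp
    ultimately show ?thesis
      using that c by (auto simp: s composable_def Comp_in Dom_Comp Cod_Comp)
  qed
next
  fix A assume A: "A \<in> Ob (Split C)"
  obtain X p where "A = (X, p)" by (cases A)
  then show "One (Split C) A \<in> Mor (Split C)"
    and "Dom (Split C) (One (Split C) A) = A"
    and "Cod (Split C) (One (Split C) A) = A"
    and "Dag (Split C) (One (Split C) A) = One (Split C) A"
    using A by (auto simp: Split_simps dagger_idempotent_def)
qed

lemma groupoid_quot: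
  assumes "groupoid G" "a \<in> Mor G" "b \<in> Mor G" "Cod G a = Cod G b"
  shows "Comp G (inv_mor G a) b \<in> Mor G"
    "Dom G (Comp G (inv_mor G a) b) = Dom G b"
    "Cod G (Comp G (inv_mor G a) b) = Dom G a"
    "inv_mor G (Comp G (inv_mor G a) b) = Comp G (inv_mor G b) a"
proof -
  interpret category G using assms(1) by (simp add: groupoid_def)
  have c: "composable G (inv_mor G a) b" "composable G (inv_mor G b) a"
    "composable G b (inv_mor G b)" "composable G a (inv_mor G a)"
    "composable G (inv_mor G a) a" "composable G (inv_mor G b) b"
    using groupoid_inverse[OF assms(1)] assms(2-) by (auto simp: composable_def)
  show 1: "Comp G (inv_mor G a) b \<in> Mor G"
    "Dom G (Comp G (inv_mor G a) b) = Dom G b"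
    "Cod G (Comp G (inv_mor G a) b) = Dom G a"
    using c(1) groupoid_inverse[OF assms(1)] assms(2-)
    by (auto simp: Comp_in Dom_Comp Cod_Comp)
  have 2: "Comp G (inv_mor G b) a \<in> Mor G"
    "Dom G (Comp G (inv_mor G b) a) = Dom G a"
    "Cod G (Comp G (inv_mor G b) a) = Dom G b"
    using c(2) groupoid_inverse[OF assms(1)] assms(2-)
    by (auto simp: Comp_in Dom_Comp Cod_Comp)
  have cancel: "Comp G (Comp G (inv_mor G x) y) (Comp G (inv_mor G y) x) = One G (Dom G x)"
    if x: "x \<in> Mor G" and y: "y \<in> Mor G" and "Cod G x = Cod G y" for x y
  proof -
    note gi = groupoid_inverse[OF assms(1) x] groupoid_inverse[OF assms(1) y]
    have yx: "composable G (inv_mor G y) x" using gi that by (simp add: composable_def)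
    have "Comp G (Comp G (inv_mor G x) y) (Comp G (inv_mor G y) x)
        = Comp G (inv_mor G x) (Comp G y (Comp G (inv_mor G y) x))"
      by (rule Comp_assoc) (use gi that yx in \<open>auto simp: composable_def Comp_in Cod_Comp\<close>)
    also have "Comp G y (Comp G (inv_mor G y) x) = Comp G (Comp G y (inv_mor G y)) x"
      by (rule Comp_assoc[symmetric]) (use gi that in \<open>auto simp: composable_def\<close>)
    also have "\<dots> = x" using gi that Comp_One_left[OF x] by simp
    finally show ?thesis using gi by simp
  qed
  show "inv_mor G (Comp G (inv_mor G a) b) = Comp G (inv_mor G b) a"
    by (rule inv_mor_eqI)
      (use 1 2 cancel assms in \<open>auto simp: inverse_morphisms_def composable_def\<close>)
qed

lemma quot_rel_iff:
  assumes "groupoid G" "groupoid H"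
  shows "((a, b), (c, d)) \<in> quot_rel G H R \<longleftrightarrow>
    a \<in> Mor G \<and> b \<in> Mor G \<and> c \<in> Mor H \<and> d \<in> Mor H \<and> Cod G a = Cod G b \<and> Cod H c = Cod H d \<and>
    (Comp G (inv_mor G a) b, Comp H (inv_mor H c) d) \<in> R"
  using groupoid_inverse[OF assms(1)] groupoid_inverse[OF assms(2)]
  by (auto simp: quot_rel_def composable_def)

lemma quot_rel_relcomp:
  assumes "groupoid G" "groupoid H" "groupoid K"
    and R: "\<And>g h. (g, h) \<in> R \<Longrightarrow> g \<in> Mor G \<Longrightarrow> h \<in> Mor H"
  shows "quot_rel G H R O quot_rel H K S = quot_rel G K (R O S)" (is "?l = ?r")
proof (rule set_eqI)
  fix z :: "('a \<times> 'a) \<times> ('a \<times> 'a)"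
  obtain a b c d where z: "z = ((a, b), (c, d))" by (metis prod.exhaust)
  interpret H: category H using assms(2) by (simp add: groupoid_def)
  show "z \<in> ?l \<longleftrightarrow> z \<in> ?r"
  proof
    assume "z \<in> ?l"
    then obtain e f where "((a, b), (e, f)) \<in> quot_rel G H R" "((e, f), (c, d)) \<in> quot_rel H K S"
      by (auto simp: z)
    then show "z \<in> ?r" using assms by (auto simp: z quot_rel_iff)
  next
    assume "z \<in> ?r"
    then have q: "a \<in> Mor G" "b \<in> Mor G" "c \<in> Mor K" "d \<in> Mor K" "Cod G a = Cod G b"
      "Cod K c = Cod K d" and "(Comp G (inv_mor G a) b, Comp K (inv_mor K c) d) \<in> R O S"
      using assms by (auto simp: z quot_rel_iff)
    then obtain h where h: "(Comp G (inv_mor G a) b, h) \<in> R" "(h, Comp K (inv_mor K c) d) \<in> S"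
      by auto
    have hM: "h \<in> Mor H" using R[OF h(1)] groupoid_quot[OF assms(1) q(1,2,5)] by simp
    let ?e = "One H (Cod H h)"
    have ob: "Cod H h \<in> Ob H" using hM H.Cod_in by simp
    have e: "?e \<in> Mor H" "Dom H ?e = Cod H h" "Cod H ?e = Cod H h"
      using ob H.One_in H.Dom_One H.Cod_One by auto
    have "Comp H ?e ?e = ?e" using H.Comp_One_left[OF e(1)] e by simp
    then have "inv_mor H ?e = ?e"
      by (intro H.inv_mor_eqI) (use e in \<open>simp add: inverse_morphisms_def composable_def\<close>)
    then have "Comp H (inv_mor H ?e) h = h" using H.Comp_One_left[OF hM] by simp
    then have "((a, b), (?e, h)) \<in> quot_rel G H R" "((?e, h), (c, d)) \<in> quot_rel H K S"
      using assms q h hM e by (auto simp: quot_rel_iff)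
    then show "z \<in> ?l" by (auto simp: z)
  qed
qed

lemma quot_rel_converse: "(quot_rel G H R)\<inverse> = quot_rel H G (R\<inverse>)"
  by (auto simp: quot_rel_def)

lemma CPM_Rel_quot_rel:
  assumes sG: "small_groupoid U G" and sH: "small_groupoid U H"
    and inv: "\<And>g h. (g, h) \<in> R \<Longrightarrow> (inv_mor G g, inv_mor H h) \<in> R"
    and one: "\<And>g h. (g, h) \<in> R \<Longrightarrow> (One G (Dom G g), One H (Dom H h)) \<in> R"
  shows "(Mor G, quot_rel G H R, Mor H) \<in> Mor (CPM_Rel U)"
proof -
  have G: "groupoid G" and H: "groupoid H" using sG sH by (auto simp: small_groupoid_def)
  have "((b, a), (d, c)) \<in> quot_rel G H R \<and> ((a, a), (c, c)) \<in> quot_rel G H R"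
    if "((a, b), (c, d)) \<in> quot_rel G H R" for a b c d
  proof -
    from that have q: "a \<in> Mor G" "b \<in> Mor G" "c \<in> Mor H" "d \<in> Mor H" "Cod G a = Cod G b"
      "Cod H c = Cod H d" and r: "(Comp G (inv_mor G a) b, Comp H (inv_mor H c) d) \<in> R"
      using quot_rel_iff[OF G H] by auto
    have r': "(Comp G (inv_mor G b) a, Comp H (inv_mor H d) c) \<in> R"
      using inv[OF r] groupoid_quot(4)[OF G q(1,2,5)] groupoid_quot(4)[OF H q(3,4,6)] by simp
    have "(One G (Dom G a), One H (Dom H c)) \<in> R"
      using one[OF r'] groupoid_quot(2)[OF G q(2,1) q(5)[symmetric]]
        groupoid_quot(2)[OF H q(4,3) q(6)[symmetric]] by simp
    then show ?thesis
      using q r' quot_rel_iff[OF G H] groupoid_inverse(4)[OF G q(1)] groupoid_inverse(4)[OF H q(3)]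
      by simp
  qed
  moreover have "quot_rel G H R \<subseteq> (Mor G \<times> Mor G) \<times> (Mor H \<times> Mor H)"
    by (auto simp: quot_rel_def)
  moreover have "Mor G \<in> U" "Mor H \<in> U" using sG sH by (auto simp: small_groupoid_def)
  ultimately show ?thesis unfolding CPM_Rel_def rel_cat_simps by blast
qed

lemma dagger_idempotent_can_ob:
  assumes "small_groupoid U G"
  shows "dagger_idempotent (CPM_Rel U) (Mor G) (Mor G, quot_rel G G Id, Mor G)"
proof -
  have G: "groupoid G" using assms by (simp add: small_groupoid_def)
  have "quot_rel G G Id O quot_rel G G Id = quot_rel G G Id"
    using quot_rel_relcomp[OF G G G, of Id Id] by simp
  moreover have "(Mor G, quot_rel G G Id, Mor G) \<in> Mor (CPM_Rel U)"
    by (rule CPM_Rel_quot_rel[OF assms assms]) auto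
  moreover have "Mor G \<in> U" using assms by (simp add: small_groupoid_def)
  ultimately show ?thesis
    by (simp add: dagger_idempotent_def CPM_Rel_def rel_cat_simps quot_rel_converse)
qed

theorem canonical_functor_is_functor:
  "is_functor (CPstar_Rel U) (Split (CPM_Rel U)) canonical_functor"
proof -
  let ?C = "CPstar_Rel U" and ?D = "Split (CPM_Rel U)"
  note F = canonical_functor_def can_ob_def
  have gpd: "groupoid G" if "small_groupoid U G" for G using that by (simp add: small_groupoid_def)
  have C: "category ?C" using dagger_category_CPstar_Rel dagger_category.axioms(1) by blast
  have D: "category ?D" using dagger_category.dagger_category_Split[OF dagger_category_CPM_Rel]
      dagger_category.axioms(1) by blast
  have morC: "(G, R, H) \<in> Mor ?C \<longleftrightarrow> small_groupoid U G \<and> small_groupoid U H \<and>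
      R \<subseteq> Mor G \<times> Mor H \<and> (\<forall>(g, h)\<in>R. (inv_mor G g, inv_mor H h) \<in> R \<and>
        (One G (Dom G g), One H (Dom H h)) \<in> R)" for G R H
    by (simp add: CPstar_Rel_def rel_cat_simps)
  have CPM_simps: "Dom (CPM_Rel U) (X, Q, Y) = X" "Cod (CPM_Rel U) (X, Q, Y) = Y"
    "Comp (CPM_Rel U) (Y', Q', Z) (X, Q, Y) = (X, Q O Q', Z)"
    for X Y Y' Z :: "'a set" and Q Q'
    by (simp_all add: CPM_Rel_def rel_cat_simps)
  have obC: "Ob ?C = {G. small_groupoid U G}" by (simp add: CPstar_Rel_def rel_cat_simps)
  have "on_Ob canonical_functor G \<in> Ob ?D" if "G \<in> Ob ?C" for G
    using that dagger_idempotent_can_ob by (simp add: obC F Split_simps)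
  moreover have "on_Mor canonical_functor f \<in> Mor ?D \<and>
      Dom ?D (on_Mor canonical_functor f) = on_Ob canonical_functor (Dom ?C f) \<and>
      Cod ?D (on_Mor canonical_functor f) = on_Ob canonical_functor (Cod ?C f)"
    if "f \<in> Mor ?C" for f
  proof -
    obtain G R H where f: "f = (G, R, H)" by (metis prod.exhaust)
    from that have m: "small_groupoid U G" "small_groupoid U H" "R \<subseteq> Mor G \<times> Mor H"
      "\<And>g h. (g, h) \<in> R \<Longrightarrow> (inv_mor G g, inv_mor H h) \<in> R"
      "\<And>g h. (g, h) \<in> R \<Longrightarrow> (One G (Dom G g), One H (Dom H h)) \<in> R"
      by (auto simp: f morC)
    have "quot_rel G G Id O quot_rel G H R = quot_rel G H R"
      using quot_rel_relcomp[of G G H Id R] gpd m by simp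
    moreover have "quot_rel G H R O quot_rel H H Id = quot_rel G H R"
      using quot_rel_relcomp[of G H H R Id] gpd m by auto
    moreover have "(Mor G, quot_rel G H R, Mor H) \<in> Mor (CPM_Rel U)"
      by (rule CPM_Rel_quot_rel) (use m in auto)
    ultimately have "on_Mor canonical_functor f \<in> Mor ?D"
      using dagger_idempotent_can_ob[OF m(1)] dagger_idempotent_can_ob[OF m(2)]
      by (simp add: f F Split_simps CPM_simps)
    then show ?thesis by (simp add: f F Split_simps) (simp add: CPstar_Rel_def rel_cat_simps)
  qed
  moreover have "on_Mor canonical_functor (One ?C G) = One ?D (on_Ob canonical_functor G)"
    if "G \<in> Ob ?C" for G
  proof -
    have G: "groupoid G" using that gpd by (simp add: obC)
    have "quot_rel G G (Id_on (Mor G)) = quot_rel G G Id"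
      using quot_rel_iff[OF G G] groupoid_quot(1)[OF G] by auto
    then show ?thesis by (simp add: F Split_simps) (simp add: CPstar_Rel_def rel_cat_simps F)
  qed
  moreover have "on_Mor canonical_functor (Comp ?C g f) =
      Comp ?D (on_Mor canonical_functor g) (on_Mor canonical_functor f)"
    if "composable ?C g f" for g f
  proof -
    obtain G R H where f: "f = (G, R, H)" by (metis prod.exhaust)
    obtain H' S K where g: "g = (H', S, K)" by (metis prod.exhaust)
    have [simp]: "H' = H" using that by (simp add: composable_def f g CPstar_Rel_def rel_cat_simps)
    have m: "small_groupoid U G" "small_groupoid U H" "small_groupoid U K" "R \<subseteq> Mor G \<times> Mor H"
      using that by (auto simp: composable_def f g morC)
    have "quot_rel G H R O quot_rel H K S = quot_rel G K (R O S)"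
      by (rule quot_rel_relcomp) (use m gpd in auto)
    then show ?thesis
      by (simp add: f g F Split_simps) (simp add: CPstar_Rel_def CPM_Rel_def rel_cat_simps F)
  qed
  ultimately show ?thesis using C D unfolding is_functor_def by blast
qed

end

(* An equivalence is essentially surjective, so it suffices to exhibit an object of
   Split(CPM[Rel]) that is not isomorphic to any F(G). For a reflexive symmetric relation D on X,
   the partial identity on D is such an idempotent. An isomorphism from F(G) identifies D with
   Mor(G) in a way compatible with sources and targets, so D inherits from composition in G that
   it is transitive. The path with three vertices (and all loops) gives a D that is not. *)

theory Submission
  imports Defs
begin

text \<open>Take \<open>A\<close> to be the image of \<open>B\<close> under a quasi-inverse
  \<open>G\<close>; the component at \<open>B\<close> of the natural isomorphism from
  \<open>F\<close> after \<open>G\<close> to the identity serves as \<open>f\<close>.\<close>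

lemma is_equivalence_ess_surj:
  assumes "is_equivalence C D F" "B \<in> Ob D"
  obtains A f where "A \<in> Ob C" "f \<in> Mor D" "Dom D f = on_Ob F A" "Cod D f = B" "is_iso D f"
proof -
  obtain G where G: "is_functor D C G" and n: "naturally_isomorphic D D (comp_functor F G) id_functor"
    using assms(1) by (auto simp: is_equivalence_def)
  from n obtain \<tau> where "\<tau> B \<in> Mor D" "Dom D (\<tau> B) = on_Ob F (on_Ob G B)" "Cod D (\<tau> B) = B"
    "is_iso D (\<tau> B)"
    using assms(2) by (auto simp: naturally_isomorphic_def comp_functor_def id_functor_def)
  moreover have "on_Ob G B \<in> Ob C" using G assms(2) by (simp add: is_functor_def)
  ultimately show thesis using that by blast
qed

lemma CPM_Rel_simps:
  "Ob (CPM_Rel U) = U"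
  "(X, R, Y) \<in> Mor (CPM_Rel U) \<longleftrightarrow> X \<in> U \<and> Y \<in> U \<and> R \<subseteq> (X \<times> X) \<times> (Y \<times> Y) \<and>
    (\<forall>((x, x'), (y, y'))\<in>R. ((x', x), (y', y)) \<in> R \<and> ((x, x), (y, y)) \<in> R)"
  "Dom (CPM_Rel U) (X, R, Y) = X"
  "Cod (CPM_Rel U) (X, R, Y) = Y"
  "Comp (CPM_Rel U) (Y', S, Z) (X, R, Y) = (X, R O S, Z)"
  "Dag (CPM_Rel U) (X, R, Y) = (Y, R\<inverse>, X)"
  by (simp_all add: CPM_Rel_def rel_cat_simps)

text \<open>A partial identity is its own converse and its own square in \<open>Rel\<close>;
  symmetry and reflexivity of \<open>D\<close> supply the two closure conditions on CPM
  morphisms.\<close>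

lemma dagger_idempotent_Id_on:
  assumes "X \<in> U" "D \<subseteq> X \<times> X" "sym D" "refl_on X D"
  shows "dagger_idempotent (CPM_Rel U) X (X, Id_on D, X)"
  using assms by (auto simp: dagger_idempotent_def CPM_Rel_simps sym_def dest: refl_onD)

text \<open>Identities in the split category are the idempotents themselves, so the inverse laws
  read \<open>R O S = p\<close> and \<open>S O R = q\<close>.\<close>

lemma Split_CPM_Rel_iso:
  assumes f: "f \<in> Mor (Split (CPM_Rel U))" and iso: "is_iso (Split (CPM_Rel U)) f"
    and dom: "Dom (Split (CPM_Rel U)) f = (X, (X, p, X))"
    and cod: "Cod (Split (CPM_Rel U)) f = (Y, (Y, q, Y))"
  obtains R S where "p O R = R" "R O q = R" "R O S = p" "S O R = q"
    "\<And>x x' y y'. ((x, x'), (y, y')) \<in> R \<Longrightarrow> ((x', x), (y', y)) \<in> R"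
    "\<And>x x' y y'. ((x, x'), (y, y')) \<in> R \<Longrightarrow> ((x, x), (y, y)) \<in> R"
proof -
  interpret dagger_category "CPM_Rel U" by (rule dagger_category_CPM_Rel)
  obtain g where g: "inverse_morphisms (Split (CPM_Rel U)) f g" using iso by (auto simp: is_iso_def)
  obtain X' R Y' where f1: "f = ((X, (X, p, X)), (X', R, Y'), (Y, (Y, q, Y)))"
    using dom cod by (cases f) (auto simp: Split_simps)
  have f2: "X' = X" "Y' = Y" "(X, R, Y) \<in> Mor (CPM_Rel U)"
    using f by (auto simp: f1 Split_simps CPM_Rel_simps)
  obtain A' X'' S Y'' B' where g1: "g = (A', (X'', S, Y''), B')" by (metis prod.exhaust)
  show thesis
  proof
    show "p O R = R" "R O q = R" using Split_absorb[OF f[unfolded f1]] f2 by (simp_all add: CPM_Rel_simps)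
    show "R O S = p" "S O R = q"
      using g unfolding inverse_morphisms_def f1 g1 f2 by (simp_all add: Split_simps CPM_Rel_simps)
  qed (use f2(3) in \<open>auto simp: CPM_Rel_simps\<close>)
qed

text \<open>The class of \<open>(a, b)\<close> under \<open>?q\<close> stands for the arrow
  \<open>inv a * b\<close> from \<open>Dom b\<close> to \<open>Dom a\<close>. The isomorphism
  matches these classes bijectively with the elements of \<open>D\<close>, and diagonal pairs, which
  stand for identities, with loops.\<close>

lemma trans_if_iso_can_ob:
  assumes H: "groupoid H"
    and f: "f \<in> Mor (Split (CPM_Rel U))" "is_iso (Split (CPM_Rel U)) f"
      "Dom (Split (CPM_Rel U)) f = can_ob H"
      "Cod (Split (CPM_Rel U)) f = (X, (X, Id_on D, X))"
  shows "trans D"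
proof (rule transI)
  let ?q = "quot_rel H H Id"
  obtain R S where qR: "?q O R = R" and RD: "R O Id_on D = R" and RS: "R O S = ?q"
    and SR: "S O R = Id_on D"
    and flip: "\<And>x x' y y'. ((x, x'), (y, y')) \<in> R \<Longrightarrow> ((x', x), (y', y)) \<in> R"
    and diag: "\<And>x x' y y'. ((x, x'), (y, y')) \<in> R \<Longrightarrow> ((x, x), (y, y)) \<in> R"
    using f by (auto simp: can_ob_def elim!: Split_CPM_Rel_iso)
  have diag': "((x', x'), (y', y')) \<in> R" if "((x, x'), (y, y')) \<in> R" for x x' y y'
    using diag[OF flip[OF that]] .
  interpret category H using H by (simp add: groupoid_def)
  have q_refl: "((a, b), (a, b)) \<in> ?q \<longleftrightarrow> a \<in> Mor H \<and> b \<in> Mor H \<and> Cod H a = Cod H b" for a b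
    using quot_rel_iff[OF H H] by auto
  have q_diag: "((a, a), (b, b)) \<in> ?q \<longleftrightarrow> a \<in> Mor H \<and> b \<in> Mor H \<and> Dom H a = Dom H b" for a b
    using quot_rel_iff[OF H H] groupoid_inverse(4)[OF H] Dom_One Dom_in by (auto, metis)
  have q_sym: "(w, v) \<in> ?q" if "(v, w) \<in> ?q" for v w
    using that quot_rel_converse[of H H Id] by (metis converse.intros converse_Id)
  have q_trans: "(u, w) \<in> ?q" if "(u, v) \<in> ?q" "(v, w) \<in> ?q" for u v w
    using that quot_rel_relcomp[OF H H H, of Id Id] by auto
  have inD: "e \<in> D" if "(v, e) \<in> R" for v e using that RD by auto
  \<comment> \<open>A symmetric and transitive relation is reflexive on its field.\<close>
  have dom: "(v, v) \<in> ?q" if ve: "(v, e) \<in> R" for v e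
  proof -
    have "(v, e) \<in> ?q O R" using ve qR by simp
    then obtain w where "(v, w) \<in> ?q" by blast
    then show ?thesis using q_sym q_trans by blast
  qed
  have surj: "\<exists>a b. ((a, b), e) \<in> R" if "e \<in> D" for e
    using SR that by (metis Id_onI relcompEpair surj_pair)
  have inj: "(v, w) \<in> ?q" if ve: "(v, e) \<in> R" "(w, e) \<in> R" for v w e
  proof -
    have "(e, e) \<in> S O R" using SR inD[OF ve(1)] by auto
    then obtain u where "(e, u) \<in> S" by blast
    then have "(v, u) \<in> ?q" "(w, u) \<in> ?q" using RS ve by blast+
    then show ?thesis using q_sym q_trans by blast
  qed
  have single_valued: "e = e'" if ve: "(v, e) \<in> R" "(v, e') \<in> R" for v e e'
  proof -
    have "(v, v) \<in> R O S" using RS dom[OF ve(1)] by simp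
    then obtain d where "(d, v) \<in> S" by blast
    then have "(d, e) \<in> Id_on D" "(d, e') \<in> Id_on D" using ve SR by blast+
    then show ?thesis by auto
  qed
  fix x y z
  assume "(x, y) \<in> D" "(y, z) \<in> D"
  then obtain a b c d where ab: "((a, b), (x, y)) \<in> R" and cd: "((c, d), (y, z)) \<in> R"
    using surj by meson
  have m: "a \<in> Mor H" "b \<in> Mor H" "Cod H a = Cod H b" "c \<in> Mor H" "d \<in> Mor H" "Cod H c = Cod H d"
    using dom[OF ab] dom[OF cd] q_refl by auto
  \<comment> \<open>Both \<open>(b, b)\<close> and \<open>(c, c)\<close> are sent to the loop
    \<open>(y, y)\<close>, so the arrows for \<open>(x, y)\<close> and \<open>(y, z)\<close> are
    composable.\<close>
  have bc: "Dom H b = Dom H c"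
    using inj[OF diag'[OF ab] diag[OF cd]] q_diag by simp
  \<comment> \<open>With \<open>?m = b * inv c * d\<close>, the pair \<open>(a, ?m)\<close> stands
    for the product of the two arrows, \<open>inv a * b * inv c * d\<close>.\<close>
  let ?n = "Comp H (inv_mor H c) d"
  let ?m = "Comp H b ?n"
  have n: "composable H b ?n" "Dom H ?n = Dom H d"
    using groupoid_quot[OF H m(4-6)] m bc by (auto simp: composable_def)
  have k: "?m \<in> Mor H" "Dom H ?m = Dom H d" "Cod H ?m = Cod H a"
    using Comp_in[OF n(1)] Dom_Comp[OF n(1)] Cod_Comp[OF n(1)] n m by auto
  have "((a, ?m), (a, ?m)) \<in> ?q" using q_refl k m by simp
  then obtain u v where uv: "((a, ?m), (u, v)) \<in> R" using RS by (metis relcompEpair surj_pair)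
  \<comment> \<open>The endpoints of the image \<open>(u, v)\<close> are read off from the images of
    the diagonal pairs \<open>(a, a)\<close> and \<open>(?m, ?m)\<close>.\<close>
  have "u = x" using single_valued[OF diag[OF uv] diag[OF ab]] by simp
  \<comment> \<open>\<open>?m\<close> and \<open>d\<close> have the same domain, so their diagonal
    pairs stand for the same identity, which goes to \<open>(z, z)\<close>.\<close>
  moreover have "((?m, ?m), (d, d)) \<in> ?q" using q_diag k m by simp
  then have "((?m, ?m), (z, z)) \<in> R" using diag'[OF cd] qR by blast
  then have "v = z" using single_valued[OF diag'[OF uv]] by blast
  ultimately show "(x, z) \<in> D" using inD[OF uv] by simp
qed

theorem corollary2p9:
  fixes U :: "'u set set"
  assumes "set_universe U"
  shows "\<not> is_equivalence (CPstar_Rel U) (Split (CPM_Rel U)) canonical_functor"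
proof
  assume eq: "is_equivalence (CPstar_Rel U) (Split (CPM_Rel U)) canonical_functor"
  \<comment> \<open>Three points exist because the type is infinite; finiteness then puts
    \<open>X\<close> in \<open>U\<close>.\<close>
  obtain X :: "'u set" where "card X = 3" "finite X"
    using assms infinite_arbitrarily_large by (metis set_universe_def)
  then obtain x y z where X: "X = {x, y, z}" and ne: "x \<noteq> y" "y \<noteq> z" "x \<noteq> z"
    by (auto simp: card_3_iff)
  define D where "D = X \<times> X - {(x, z), (z, x)}"
  have "X \<in> U" using assms \<open>finite X\<close> by (simp add: set_universe_def)
  moreover have "D \<subseteq> X \<times> X" "sym D" "refl_on X D"
    using ne by (auto simp: D_def sym_def refl_on_def)
  ultimately have "(X, (X, Id_on D, X)) \<in> Ob (Split (CPM_Rel U))"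
    by (simp add: Split_simps dagger_idempotent_Id_on)
  from is_equivalence_ess_surj[OF eq this] obtain H f where H: "H \<in> Ob (CPstar_Rel U)"
    and f: "f \<in> Mor (Split (CPM_Rel U))" "Dom (Split (CPM_Rel U)) f = on_Ob canonical_functor H"
      "Cod (Split (CPM_Rel U)) f = (X, (X, Id_on D, X))" "is_iso (Split (CPM_Rel U)) f"
    by metis
  have "groupoid H" using H by (simp add: CPstar_Rel_def rel_cat_simps small_groupoid_def)
  then have "trans D"
    using f trans_if_iso_can_ob[of H f U X D] by (simp add: canonical_functor_def)
  moreover have "(x, y) \<in> D" "(y, z) \<in> D" "(x, z) \<notin> D" using ne by (auto simp: D_def X)
  ultimately show False by (meson transE)
qed

end
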